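(* Let $(\mathbb{X},\oplus,\otimes,\mathbb{0},\mathbb{1})$ be a linearly ordered radicable idempotent semifield, let $n\geq 1$, let $\mathbf{p}\in\mathbb{X}^{n}$ be a nonzero vector and $\mathbf{q}\in\mathbb{X}^{n}$ a regular vector. Consider the problem of minimizing $\mathbf{q}^{-}\mathbf{x}\mathbf{x}^{-}\mathbf{p}$ over all regular vectors $\mathbf{x}\in\mathbb{X}^{n}$. Then the minimum value in this problem is equal to $$\Delta=\mathbf{q}^{-}\mathbf{p},$$ and all regular solutions of the problem are given by $$\alpha\mathbf{p}\leq\mathbf{x}\leq\alpha\Delta\mathbf{q},\qquad \alpha>\mathbb{0};$$ that is, a regular vector $\mathbf{x}$ attains the minimum if and only if there is a scalar $\alpha\in\mathbb{X}$, $\alpha>\mathbb{0}$, for which this double inequality holds.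
   Context: Idempotent semifield: $\mathbb{X}$ is a set with two associative and commutative operations $\oplus$ (addition) and $\otimes$ (multiplication, sign usually omitted) with neutral elements $\mathbb{0}$ and $\mathbb{1}$ respectively; addition is idempotent ($x\oplus x=x$), multiplication distributes over addition, and each $x\neq\mathbb{0}$ has a multiplicative inverse $x^{-1}$ (and $\mathbb{0}$ is absorbing for multiplication). The order is defined by $x\leq y$ iff $x\oplus y=y$ and is assumed linear, so $x\oplus y=\max(x,y)$; "minimize" refers to this order. Radicable means that $x^{m}=a$ has a solution for every $a\neq\mathbb{0}$ and every integer $m\geq1$. Vectors and matrices: vectors in $\mathbb{X}^{n}$ are column vectors; matrix/vector operations follow the usual rules with $\oplus,\otimes$ in place of ordinary addition and multiplication; vector inequalities are componentwise. A vector is nonzero if it has at least one entry $\neq\mathbb{0}$, and regular if none of its entries is $\mathbb{0}$. For a nonzero column vector $\mathbf{x}=(x_{i})$, the multiplicative conjugate transpose is the row vector $\mathbf{x}^{-}=(x_{i}^{-})$ with $x_{i}^{-}=x_{i}^{-1}$ if $x_{i}\neq\mathbb{0}$ and $x_{i}^{-}=\mathbb{0}$ otherwise. Thus $\mathbf{q}^{-}\mathbf{x}\mathbf{x}^{-}\mathbf{p}=(\bigoplus_{i}q_{i}^{-1}x_{i})(\bigoplus_{i}x_{i}^{-1}p_{i})$. *)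

theory Defs
  imports "HOL-Analysis.Finite_Cartesian_Product"
begin

text \<open>
  In the following classes \<open>+\<close>, \<open>*\<close>, \<open>0\<close>, \<open>1\<close> stand for the idempotent addition, the
  multiplication and their neutral elements. Totality of \<open>inverse\<close> and \<open>/\<close> is
  handled by the same conventions as in class \<^class>\<open>field\<close>. The condition \<open>0 \<noteq> 1\<close> that
  comes with \<^class>\<open>comm_semiring_1\<close> only excludes the one-element structure, over
  which there are no nonzero vectors.
\<close>

class linordered_idempotent_semifield = comm_semiring_1 + inverse + linorder +
  assumes add_idem: "x + x = x"
    and left_inverse_semifield: "x \<noteq> 0 \<Longrightarrow> inverse x * x = 1"
    and divide_inverse_semifield: "x / y = x * inverse y"
    and inverse_zero_semifield: "inverse 0 = 0"
    and le_iff_add_eq: "x \<le> y \<longleftrightarrow> x + y = y"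

class radicable_linordered_idempotent_semifield = linordered_idempotent_semifield +
  assumes radicable: "a \<noteq> 0 \<Longrightarrow> 1 \<le> (m::nat) \<Longrightarrow> \<exists>x. x ^ m = a"

definition regular_vec :: "'a::zero ^ 'n \<Rightarrow> bool" where
  "regular_vec x \<longleftrightarrow> (\<forall>i. x $ i \<noteq> 0)"

text \<open>
  Row and column vectors share one type; the product of a row vector with a column
  vector is \<^const>\<open>scalar_product\<close>, whose sum is the idempotent one.
\<close>

definition conj_transpose ::
  "'a::linordered_idempotent_semifield ^ 'n \<Rightarrow> 'a ^ 'n"  (\<open>(_\<^sup>-)\<close> [1000] 999) where
  "x\<^sup>- = (\<chi> i. if x $ i \<noteq> 0 then inverse (x $ i) else 0)"

definition objective ::
  "'a::linordered_idempotent_semifield ^ 'n \<Rightarrow> 'a ^ 'n \<Rightarrow> 'a ^ 'n \<Rightarrow> 'a" where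
  "objective p q x = scalar_product (q\<^sup>-) x * scalar_product (x\<^sup>-) p"

end

theory Submission
  imports Defs
begin

text \<open>
  In a linearly ordered idempotent semifield a finite sum is the least upper bound of its terms,
  with bottom element \<open>0\<close>, and multiplication by a nonzero scalar is an order isomorphism. So
  the single scalar inequality \<open>q\<^sup>- x \<le> c\<close> is equivalent to the vector inequality \<open>x \<le> c q\<close> for
  regular \<open>q\<close> (\<open>conj_transpose_product_le_iff\<close>), a form of residuation on which everything rests.

  The choice \<open>c = q\<^sup>- x\<close> gives \<open>x \<le> (q\<^sup>- x) q\<close>, and likewise \<open>p \<le> (x\<^sup>- p) x\<close>. Combining the two,
  \<open>p \<le> (q\<^sup>- x) (x\<^sup>- p) q\<close>, which by residuation is the lower bound \<open>\<Delta> \<le> (q\<^sup>- x) (x\<^sup>- p)\<close>.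
  When the bound is attained, the scalar \<open>\<alpha> = (x\<^sup>- p)\<^sup>-\<^sup>1\<close> turns the same two vector inequalities
  into \<open>\<alpha> p \<le> x\<close> and \<open>x \<le> \<alpha> \<Delta> q\<close>. Conversely, these two inequalities say
  \<open>x\<^sup>- p \<le> \<alpha>\<^sup>-\<^sup>1\<close> and \<open>q\<^sup>- x \<le> \<alpha> \<Delta>\<close>, so the objective is at most \<open>\<Delta>\<close>. The vector \<open>\<Delta> q\<close> satisfies
  them with \<open>\<alpha> = 1\<close>, so the bound is attained. The assumption \<open>p \<noteq> 0\<close> enters through
  \<open>conj_transpose_product_nonzero\<close>: it makes \<open>x\<^sup>- p\<close> invertible and \<open>\<Delta> q\<close> regular.
\<close>

lemma semifield_zero_le: "(0::'a::linordered_idempotent_semifield) \<le> x"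
  by (simp add: le_iff_add_eq)

lemma semifield_pos_iff: "(0::'a::linordered_idempotent_semifield) < x \<longleftrightarrow> x \<noteq> 0"
  using semifield_zero_le[of x] by auto

lemma semifield_mult_left_mono:
  fixes a b c :: "'a::linordered_idempotent_semifield"
  assumes "a \<le> b"
  shows "c * a \<le> c * b"
  using assms by (simp add: le_iff_add_eq flip: distrib_left)

lemma semifield_inverse_nonzero:
  fixes a :: "'a::linordered_idempotent_semifield"
  assumes "a \<noteq> 0"
  shows "inverse a \<noteq> 0"
  using left_inverse_semifield[OF assms] by auto

lemma semifield_mult_nonzero:
  fixes a b :: "'a::linordered_idempotent_semifield"
  assumes "a \<noteq> 0" and "b \<noteq> 0"
  shows "a * b \<noteq> 0"
proof
  assume "a * b = 0"
  then have "inverse a * a * b = 0" by (simp add: mult.assoc)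
  with assms show False by (simp add: left_inverse_semifield)
qed

text \<open>
  Residuation for scalars: each direction multiplies by a scalar, and the two factors cancel.
\<close>

lemma semifield_inverse_mult_le_iff:
  fixes a b c :: "'a::linordered_idempotent_semifield"
  assumes "a \<noteq> 0"
  shows "inverse a * b \<le> c \<longleftrightarrow> b \<le> c * a"
proof
  assume "inverse a * b \<le> c"
  then have "a * (inverse a * b) \<le> a * c" by (rule semifield_mult_left_mono)
  moreover have "a * (inverse a * b) = (inverse a * a) * b" by (simp only: ac_simps)
  ultimately show "b \<le> c * a"
    by (simp only: left_inverse_semifield[OF assms] mult_1 mult.commute[of a c])
next
  assume "b \<le> c * a"
  then have "inverse a * b \<le> inverse a * (c * a)" by (rule semifield_mult_left_mono)
  moreover have "inverse a * (c * a) = c * (inverse a * a)" by (simp only: ac_simps)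
  ultimately show "inverse a * b \<le> c"
    by (simp only: left_inverse_semifield[OF assms] mult_1_right)
qed

text \<open>
  Idempotent addition is the maximum; the empty sum causes no exception because \<open>0\<close> is the least
  element.
\<close>

lemma idempotent_add_le_iff:
  fixes a b c :: "'a::linordered_idempotent_semifield"
  shows "a + b \<le> c \<longleftrightarrow> a \<le> c \<and> b \<le> c"
proof (cases "a \<le> b")
  case True
  moreover from True have "a + b = b" by (simp only: le_iff_add_eq)
  ultimately show ?thesis by (auto intro: order.trans)
next
  case False
  then have "b \<le> a" by simp
  moreover from this have "a + b = a" by (simp only: le_iff_add_eq add.commute[of a b])
  ultimately show ?thesis by (auto intro: order.trans)
qed

lemma idempotent_sum_le_iff:
  fixes f :: "'b \<Rightarrow> 'a::linordered_idempotent_semifield"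
  assumes "finite A"
  shows "sum f A \<le> c \<longleftrightarrow> (\<forall>i\<in>A. f i \<le> c)"
  using assms by (induction A) (auto simp: idempotent_add_le_iff semifield_zero_le)

lemma conj_transpose_product_le_iff:
  fixes q x :: "'a::linordered_idempotent_semifield ^ 'n"
  assumes "regular_vec q"
  shows "scalar_product (q\<^sup>-) x \<le> c \<longleftrightarrow> x \<le> c *s q"
  using assms
  by (simp add: scalar_product_def conj_transpose_def regular_vec_def idempotent_sum_le_iff
      semifield_inverse_mult_le_iff less_eq_vec_def)

lemma le_conj_transpose_product_scale:
  fixes q x :: "'a::linordered_idempotent_semifield ^ 'n"
  assumes "regular_vec q"
  shows "x \<le> scalar_product (q\<^sup>-) x *s q"
  by (rule iffD1[OF conj_transpose_product_le_iff[OF assms] order.refl])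

text \<open>
  If the product vanished, residuation would bound \<open>x\<close> by the zero vector.
\<close>

lemma conj_transpose_product_nonzero:
  fixes q x :: "'a::linordered_idempotent_semifield ^ 'n"
  assumes "regular_vec q" and "x \<noteq> 0"
  shows "scalar_product (q\<^sup>-) x \<noteq> 0"
proof
  assume "scalar_product (q\<^sup>-) x = 0"
  then have "x \<le> 0 *s q" using le_conj_transpose_product_scale[OF assms(1), of x] by simp
  then have "x $ i = 0" for i
    using semifield_zero_le[of "x $ i"] by (auto simp: less_eq_vec_def intro: order.antisym)
  with assms(2) show False by (simp add: vec_eq_iff)
qed

lemma le_inverse_scale:
  fixes p x :: "'a::linordered_idempotent_semifield ^ 'n"
  assumes "\<alpha> \<noteq> 0" and "\<alpha> *s p \<le> x"
  shows "p \<le> inverse \<alpha> *s x"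
proof -
  have "p $ i \<le> inverse \<alpha> * x $ i" for i
  proof -
    have "inverse \<alpha> * (\<alpha> * p $ i) \<le> inverse \<alpha> * x $ i"
      using assms(2) by (intro semifield_mult_left_mono) (simp add: less_eq_vec_def)
    then show ?thesis
      using assms(1) by (simp add: left_inverse_semifield flip: mult.assoc)
  qed
  then show ?thesis by (simp add: less_eq_vec_def)
qed

lemma objective_lower_bound:
  fixes p q x :: "'a::linordered_idempotent_semifield ^ 'n"
  assumes "regular_vec q" and "regular_vec x"
  shows "scalar_product (q\<^sup>-) p \<le> objective p q x"
proof -
  let ?a = "scalar_product (x\<^sup>-) p" and ?b = "scalar_product (q\<^sup>-) x"
  have "p $ i \<le> (?b * ?a) * q $ i" for i
  proof -
    have "p $ i \<le> ?a * x $ i"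
      using le_conj_transpose_product_scale[OF assms(2), of p] by (simp add: less_eq_vec_def)
    also have "\<dots> \<le> ?a * (?b * q $ i)"
      using le_conj_transpose_product_scale[OF assms(1), of x]
      by (intro semifield_mult_left_mono) (simp add: less_eq_vec_def)
    finally show ?thesis by (simp add: ac_simps)
  qed
  then have "p \<le> (?b * ?a) *s q" by (simp add: less_eq_vec_def)
  then show ?thesis
    by (simp add: objective_def conj_transpose_product_le_iff[OF assms(1)])
qed

lemma objective_le_if_between:
  fixes p q x :: "'a::linordered_idempotent_semifield ^ 'n"
  assumes "regular_vec q" and "regular_vec x" and "\<alpha> \<noteq> 0"
    and "\<alpha> *s p \<le> x" and "x \<le> (\<alpha> * \<beta>) *s q"
  shows "objective p q x \<le> \<beta>"
proof -
  have "scalar_product (x\<^sup>-) p \<le> inverse \<alpha>"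
    using assms by (simp add: conj_transpose_product_le_iff le_inverse_scale)
  then have "objective p q x \<le> scalar_product (q\<^sup>-) x * inverse \<alpha>"
    unfolding objective_def by (rule semifield_mult_left_mono)
  also have "\<dots> = inverse \<alpha> * scalar_product (q\<^sup>-) x" by (rule mult.commute)
  also have "\<dots> \<le> inverse \<alpha> * (\<alpha> * \<beta>)"
    using assms by (intro semifield_mult_left_mono) (simp add: conj_transpose_product_le_iff)
  also have "\<dots> = \<beta>"
    using left_inverse_semifield[OF assms(3)] by (simp flip: mult.assoc)
  finally show ?thesis .
qed

lemma between_if_objective_le:
  fixes p q x :: "'a::linordered_idempotent_semifield ^ 'n"
  assumes "p \<noteq> 0" and "regular_vec q" and "regular_vec x" and "objective p q x \<le> \<beta>"
  shows "\<exists>\<alpha>>0. \<alpha> *s p \<le> x \<and> x \<le> (\<alpha> * \<beta>) *s q"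
proof -
  let ?a = "scalar_product (x\<^sup>-) p" and ?b = "scalar_product (q\<^sup>-) x"
  have a: "?a \<noteq> 0" by (rule conj_transpose_product_nonzero[OF assms(3,1)])
  have "p $ i \<le> x $ i * ?a" for i
    using le_conj_transpose_product_scale[OF assms(3), of p]
    by (simp add: less_eq_vec_def mult.commute)
  then have "inverse ?a *s p \<le> x"
    by (simp add: less_eq_vec_def semifield_inverse_mult_le_iff[OF a])
  moreover have "?b \<le> inverse ?a * \<beta>"
  proof -
    have "?b = (inverse ?a * ?a) * ?b" using left_inverse_semifield[OF a] by simp
    also have "\<dots> = inverse ?a * objective p q x"
      unfolding objective_def by (simp only: ac_simps)
    also have "\<dots> \<le> inverse ?a * \<beta>" using assms(4) by (rule semifield_mult_left_mono)
    finally show ?thesis .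
  qed
  then have "x \<le> (inverse ?a * \<beta>) *s q"
    by (simp add: conj_transpose_product_le_iff[OF assms(2)])
  moreover have "inverse ?a > 0"
    using semifield_inverse_nonzero[OF a] by (simp add: semifield_pos_iff)
  ultimately show ?thesis by blast
qed

theorem theorem6:
  fixes p q :: "'a::radicable_linordered_idempotent_semifield ^ 'n"
    and \<Delta> :: 'a
  assumes "p \<noteq> 0"
    and "regular_vec q"
    and "\<Delta> = scalar_product (q\<^sup>-) p"
  shows "(\<exists>x. regular_vec x \<and> objective p q x = \<Delta>) \<and>
         (\<forall>x. regular_vec x \<longrightarrow> \<Delta> \<le> objective p q x) \<and>
         (\<forall>x. regular_vec x \<longrightarrow>
            (is_arg_min (objective p q) regular_vec x \<longleftrightarrow>
             (\<exists>\<alpha>>0. \<alpha> *s p \<le> x \<and> x \<le> (\<alpha> * \<Delta>) *s q)))"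
proof -
  have lower: "\<Delta> \<le> objective p q x" if "regular_vec x" for x
    using objective_lower_bound[OF assms(2) that] assms(3) by simp
  have "\<Delta> \<noteq> 0"
    unfolding assms(3) by (rule conj_transpose_product_nonzero[OF assms(2,1)])
  then have reg: "regular_vec (\<Delta> *s q)"
    using assms(2) by (simp add: regular_vec_def semifield_mult_nonzero)
  have "1 *s p \<le> \<Delta> *s q"
    using le_conj_transpose_product_scale[OF assms(2), of p] assms(3) by simp
  then have "objective p q (\<Delta> *s q) \<le> \<Delta>"
    by (intro objective_le_if_between[OF assms(2) reg, where \<alpha> = 1]) simp_all
  then have attained: "objective p q (\<Delta> *s q) = \<Delta>"
    using lower[OF reg] by simp
  have "is_arg_min (objective p q) regular_vec x \<longleftrightarrow> objective p q x \<le> \<Delta>"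
    if "regular_vec x" for x
    unfolding is_arg_min_def using that reg attained lower
    by (metis leD leI order.strict_trans2)
  moreover have "objective p q x \<le> \<Delta> \<longleftrightarrow> (\<exists>\<alpha>>0. \<alpha> *s p \<le> x \<and> x \<le> (\<alpha> * \<Delta>) *s q)"
    if "regular_vec x" for x
    using objective_le_if_between[OF assms(2) that] between_if_objective_le[OF assms(1,2) that]
    unfolding semifield_pos_iff by blast
  ultimately have "\<forall>x. regular_vec x \<longrightarrow> (is_arg_min (objective p q) regular_vec x \<longleftrightarrow>
      (\<exists>\<alpha>>0. \<alpha> *s p \<le> x \<and> x \<le> (\<alpha> * \<Delta>) *s q))" by simp
  moreover have "\<exists>x. regular_vec x \<and> objective p q x = \<Delta>" using reg attained by blast
  ultimately show ?thesis using lower by simp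
qed

end
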